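(* Let $\alpha$ and $\beta$ be real numbers. The inequality $$1+\frac{x^2}{3}\left(\frac{\tan x}{x}\right)^\alpha<\frac{\tan x}{x}<1+\frac{x^2}{3}\left(\frac{\tan x}{x}\right)^{\beta}$$ holds for every nonzero real $x\in(-\pi/2,\pi/2)$ if and only if $\alpha\leq1$ and $\beta\geq 6/5$.
   Context: Powers are real powers of positive real numbers (note that $\frac{\tan x}{x}>0$ for nonzero $x\in(-\pi/2,\pi/2)$). *)

theory Defs
  imports Complex_Main
begin

end

theory Submission
  imports Defs "HOL-Real_Asymp.Real_Asymp"
begin

text \<open>
  Write \<open>T = tan x / x\<close>. Everything is even in \<open>x\<close>, so only \<open>0 < x < \<pi>/2\<close> matters, where
  \<open>T > 1\<close> and hence \<open>T powr a\<close> increases with \<open>a\<close>. The theorem therefore says that the exponent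
  \<open>r(x) = ln (3 (T - 1) / x\<^sup>2) / ln T\<close> takes values strictly between \<open>1\<close> and \<open>6/5\<close> and comes
  arbitrarily close to both.

  That the constants are sharp is seen at the ends of the interval. At \<open>0\<close> the expansion
  \<open>T = 1 + x\<^sup>2/3 + 2x\<^sup>4/15 + \<dots>\<close> makes the numerator of \<open>r\<close> behave like \<open>2x\<^sup>2/5\<close> and the
  denominator like \<open>x\<^sup>2/3\<close>, so \<open>r \<rightarrow> 6/5\<close> (\<open>upper_exponent_ge\<close>). At \<open>\<pi>/2\<close> the ratio \<open>T\<close> is unbounded
  while \<open>x\<^sup>2/3\<close> stays away from \<open>0\<close>, so no power of \<open>T\<close> with exponent above \<open>1\<close> can stay below \<open>T\<close>
  (\<open>lower_exponent_le_one\<close>).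

  That the constants suffice is a matter of two inequalities. The lower one, with exponent \<open>1\<close>, is
  \<open>3x cos x < (3 - x\<^sup>2) sin x\<close> with denominators cleared, and follows by differentiating. The upper
  one, with exponent \<open>6/5\<close>, becomes after taking logarithms
  \<open>5 ln 3 < 9 ln x + 6 ln (sin x) - ln (cos x) - 5 ln (sin x - x cos x)\<close>
  (\<open>tan_ratio_log_inequality\<close>). The right-hand side tends to \<open>5 ln 3\<close> at \<open>0\<close>, so it is enough that
  it increases. The sign of its derivative is that of a trigonometric polynomial with
  polynomial coefficients (\<open>deriv_numerator\<close>), whose power series is alternating, starts at \<open>x\<^sup>8\<close>
  and has terms of decreasing size for \<open>0 < x < 2\<close>; Leibniz' criterion makes it positive
  (\<open>deriv_numerator_pos\<close>).
\<close>

section \<open>Elementary inequalities for sine and cosine\<close>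

lemma sin_gt_x_cos:
  fixes x :: real
  assumes "0 < x" "x < pi/2"
  shows "x * cos x < sin x"
proof -
  have "(\<lambda>t. sin t - t * cos t) 0 < (\<lambda>t. sin t - t * cos t) x"
  proof (rule DERIV_pos_imp_increasing_open[OF assms(1)])
    fix t assume t: "0 < t" "t < x"
    have "((\<lambda>t. sin t - t * cos t) has_real_derivative t * sin t) (at t)"
      by (auto intro!: derivative_eq_intros)
    moreover have "t * sin t > 0" using t assms by (intro mult_pos_pos sin_gt_zero) auto
    ultimately show "\<exists>y. ((\<lambda>t. sin t - t * cos t) has_real_derivative y) (at t) \<and> 0 < y" by blast
  qed (auto intro!: continuous_intros)
  then show ?thesis by simp
qed

text \<open>The derivative of the difference of the two sides is \<open>x (sin x - x cos x)\<close>.\<close>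

lemma sin_cos_cubic_lower:
  fixes x :: real
  assumes "0 < x" "x < pi/2"
  shows "3 * x * cos x < (3 - x\<^sup>2) * sin x"
proof -
  let ?g = "\<lambda>t::real. (3 - t\<^sup>2) * sin t - 3 * t * cos t"
  have "?g 0 < ?g x"
  proof (rule DERIV_pos_imp_increasing_open[OF assms(1)])
    fix t assume t: "0 < t" "t < x"
    have "(?g has_real_derivative t * (sin t - t * cos t)) (at t)"
      by (auto intro!: derivative_eq_intros simp: algebra_simps power2_eq_square)
    moreover have "t * (sin t - t * cos t) > 0"
      using t assms sin_gt_x_cos[of t] by simp
    ultimately show "\<exists>y. (?g has_real_derivative y) (at t) \<and> 0 < y" by blast
  qed (auto intro!: continuous_intros)
  then show ?thesis by simp
qed

section \<open>Positivity of the numerator of the logarithmic derivative\<close>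

text \<open>
  The numerator of the derivative of
  \<open>9 ln x + 6 ln (sin x) - ln (cos x) - 5 ln (sin x - x cos x)\<close> over the common denominator
  \<open>x sin x cos x (sin x - x cos x)\<close>.
\<close>

definition deriv_numerator :: "real \<Rightarrow> real" where
  "deriv_numerator x = 9 * (sin x)\<^sup>2 * cos x + x * sin x - 4 * x * sin x * (cos x)\<^sup>2 - 6 * x\<^sup>2 * cos x"

text \<open>
  The coefficient of \<open>x\<^bsup>2k\<^esup>\<close> in \<open>deriv_numerator\<close> without its sign \<open>(-1)\<^bsup>k\<^esup>\<close> and its
  denominator \<open>(2k)!\<close>; the three summands come from \<open>9/4 (cos x - cos 3x)\<close>, \<open>- x sin 3x\<close> and
  \<open>- 6 x\<^sup>2 cos x\<close>.
\<close>

definition deriv_numerator_coeff :: "nat \<Rightarrow> real" where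
  "deriv_numerator_coeff k = 9/4 * (1 - 9^k) + 2/3 * real k * 9^k + 12 * real k * (2 * real k - 1)"

text \<open>
  Multiple angles remove the products of sines and cosines, so that the power series can be
  read off term by term.
\<close>

lemma deriv_numerator_multiple_angle:
  "deriv_numerator x = 9/4 * (cos x - cos (3*x)) - x * sin (3*x) - 6 * x\<^sup>2 * cos x"
proof -
  have 1: "cos (3*x) = cos x - 4 * (sin x)\<^sup>2 * cos x"
  proof -
    have "cos (3*x) = ((cos x)\<^sup>2 - (sin x)\<^sup>2) * cos x - 2 * sin x * cos x * sin x"
      using cos_add[of "2*x" x] unfolding sin_double cos_double by simp
    also have "\<dots> = cos x - 4 * (sin x)\<^sup>2 * cos x"
      using sin_cos_squared_add[of x] by algebra
    finally show ?thesis .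
  qed
  have 2: "sin (3*x) = 4 * sin x * (cos x)\<^sup>2 - sin x"
  proof -
    have "sin (3*x) = 2 * sin x * cos x * cos x + ((cos x)\<^sup>2 - (sin x)\<^sup>2) * sin x"
      using sin_add[of "2*x" x] unfolding sin_double cos_double by simp
    also have "\<dots> = 4 * sin x * (cos x)\<^sup>2 - sin x"
      using sin_cos_squared_add[of x] by algebra
    finally show ?thesis .
  qed
  show ?thesis unfolding deriv_numerator_def 1 2 by (simp add: algebra_simps)
qed

text \<open>
  The series of \<open>x sin (c x)\<close> and \<open>x\<^sup>2 cos x\<close> are indexed by half the exponent of \<open>x\<close>, so that they
  can be added to the series of cosine. The shift creates a term at index \<open>0\<close>, which vanishes
  through its factor \<open>real n\<close>; this also makes the truncated exponent \<open>2 * n - 1\<close> harmless there.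
\<close>

lemma sums_x_sin:
  fixes c x :: real
  shows "(\<lambda>n. - ((-1)^n * (2 * real n) * c^(2*n-1) / fact (2*n)) * x^(2*n)) sums (x * sin (c*x))"
proof -
  let ?f = "\<lambda>n. - ((-1)^n * (2 * real n) * c^(2*n-1) / fact (2*n)) * x^(2*n)"
  have "(\<lambda>n. x * ((-1)^n / fact (2*n+1) * (c*x)^(2*n+1))) sums (x * sin (c*x))"
    by (intro sums_mult sin_paired)
  also have "(\<lambda>n. x * ((-1)^n / fact (2*n+1) * (c*x)^(2*n+1))) = (\<lambda>n. ?f (Suc n))"
  proof
    fix n :: nat
    have f: "fact (2 * Suc n) = 2 * real (Suc n) * fact (2*n+1)"
      using fact_Suc[of "2*n+1", where 'a = real] by (simp add: algebra_simps)
    have e: "2 * Suc n - 1 = 2*n+1" by simp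
    have "- ((-1)^Suc n * (2 * real (Suc n)) * c^(2*n+1) / fact (2 * Suc n)) = (-1)^n * c^(2*n+1) / fact (2*n+1)"
      unfolding f by simp
    then show "x * ((-1)^n / fact (2*n+1) * (c*x)^(2*n+1)) = ?f (Suc n)"
      unfolding e by (simp add: power_mult_distrib del: fact_Suc)
  qed
  finally show ?thesis
    by (subst (asm) sums_Suc_iff) simp
qed

lemma sums_x2_cos:
  fixes x :: real
  shows "(\<lambda>n. - ((-1)^n * (2 * real n * (2 * real n - 1)) / fact (2*n)) * x^(2*n)) sums (x\<^sup>2 * cos x)"
proof -
  let ?f = "\<lambda>n. - ((-1)^n * (2 * real n * (2 * real n - 1)) / fact (2*n)) * x^(2*n)"
  have "(\<lambda>n. x\<^sup>2 * ((-1)^n / fact (2*n) * x^(2*n))) sums (x\<^sup>2 * cos x)"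
    by (intro sums_mult cos_paired)
  also have "(\<lambda>n. x\<^sup>2 * ((-1)^n / fact (2*n) * x^(2*n))) = (\<lambda>n. ?f (Suc n))"
  proof
    fix n :: nat
    have f: "fact (2 * Suc n) = 2 * real (Suc n) * (2 * real (Suc n) - 1) * fact (2*n)"
      using fact_Suc[of "Suc (2*n)", where 'a = real] fact_Suc[of "2*n", where 'a = real]
      by (simp add: algebra_simps)
    have nz: "2 * real (Suc n) * (2 * real (Suc n) - 1) \<noteq> 0" by simp
    have "- ((-1)^Suc n * (2 * real (Suc n) * (2 * real (Suc n) - 1)) / fact (2 * Suc n)) = (-1)^n / fact (2*n)"
      unfolding f using nz by (simp del: of_nat_Suc)
    moreover have "x^(2 * Suc n) = x\<^sup>2 * x^(2*n)" by (simp flip: power_add)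
    ultimately show "x\<^sup>2 * ((-1)^n / fact (2*n) * x^(2*n)) = ?f (Suc n)" by (simp only: mult.left_commute)
  qed
  finally show ?thesis
    by (subst (asm) sums_Suc_iff) simp
qed

lemma deriv_numerator_sums:
  "(\<lambda>n. (-1)^n * (deriv_numerator_coeff n / fact (2*n) * x^(2*n))) sums deriv_numerator x"
proof -
  have "(\<lambda>n. 9/4 * ((-1)^n / fact (2*n) * x^(2*n) - (-1)^n / fact (2*n) * (3*x)^(2*n))
       - (- ((-1)^n * (2 * real n) * 3^(2*n-1) / fact (2*n)) * x^(2*n))
       - 6 * (- ((-1)^n * (2 * real n * (2 * real n - 1)) / fact (2*n)) * x^(2*n))) sums
     (9/4 * (cos x - cos (3*x)) - x * sin (3*x) - 6 * (x\<^sup>2 * cos x))"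
    by (intro sums_diff sums_mult cos_paired sums_x_sin sums_x2_cos)
  moreover have "(\<lambda>n. 9/4 * ((-1)^n / fact (2*n) * x^(2*n) - (-1)^n / fact (2*n) * (3*x)^(2*n))
       - (- ((-1)^n * (2 * real n) * 3^(2*n-1) / fact (2*n)) * x^(2*n))
       - 6 * (- ((-1)^n * (2 * real n * (2 * real n - 1)) / fact (2*n)) * x^(2*n))) =
     (\<lambda>n. (-1)^n * (deriv_numerator_coeff n / fact (2*n) * x^(2*n)))"
  proof
    fix n :: nat
    have regroup: "u * (e / F * X - e / F * (N * X)) - (- (e * M / F) * X) - 6 * (- (e * K / F) * X)
        = e * ((u * (1 - N) + M + 6 * K) / F * X)" for u e F X N M K :: real
      by (simp add: divide_inverse[of _ F] algebra_simps)
    have p: "(3*x)^(2*n) = 9^n * x^(2*n)" by (simp add: power_mult power_mult_distrib)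
    have q: "real n * 3^(2*n-1) = real n * 9^n / 3"
      by (cases n) (simp_all add: power_mult)
    have "(-1)^n * (2 * real n) * 3^(2*n-1) = (-1)^n * (2 * (real n * 3^(2*n-1)))"
      by simp
    also have "\<dots> = (-1)^n * (2/3 * real n * 9^n)" unfolding q by simp
    finally have r: "(-1)^n * (2 * real n) * 3^(2*n-1) = (-1)^n * (2/3 * real n * 9^n)" .
    show "9/4 * ((-1)^n / fact (2*n) * x^(2*n) - (-1)^n / fact (2*n) * (3*x)^(2*n))
       - (- ((-1)^n * (2 * real n) * 3^(2*n-1) / fact (2*n)) * x^(2*n))
       - 6 * (- ((-1)^n * (2 * real n * (2 * real n - 1)) / fact (2*n)) * x^(2*n)) =
     (-1)^n * (deriv_numerator_coeff n / fact (2*n) * x^(2*n))"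
      unfolding p r deriv_numerator_coeff_def by (rule trans[OF regroup]) (simp add: algebra_simps)
  qed
  ultimately show ?thesis by (simp add: deriv_numerator_multiple_angle mult.assoc)
qed

lemma deriv_numerator_coeff_pos: "n \<ge> 4 \<Longrightarrow> deriv_numerator_coeff n > 0"
proof -
  assume n: "n \<ge> 4"
  have "(2/3 * real n - 9/4) * 9^n \<ge> 0" using n by (intro mult_nonneg_nonneg) auto
  moreover have "12 * real n * (2 * real n - 1) \<ge> 0" using n by (intro mult_nonneg_nonneg) auto
  moreover have "deriv_numerator_coeff n = (2/3 * real n - 9/4) * 9^n + 12 * real n * (2 * real n - 1) + 9/4"
    unfolding deriv_numerator_coeff_def by algebra
  ultimately show ?thesis by linarith
qed

text \<open>
  The factor \<open>21\<close> is attained at \<open>n = 4\<close>. It is small enough for the series: consecutive terms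
  have quotient of absolute values at most \<open>21 x\<^sup>2 / ((2n+1)(2n+2))\<close>, which is at most \<open>84/90\<close> if \<open>x\<^sup>2 < 4\<close> and \<open>n \<ge> 4\<close>.
\<close>

lemma deriv_numerator_coeff_growth: "n \<ge> 4 \<Longrightarrow> deriv_numerator_coeff (Suc n) \<le> 21 * deriv_numerator_coeff n"
proof (cases "n = 4")
  case True then show ?thesis by (simp add: deriv_numerator_coeff_def)
next
  case False
  assume "n \<ge> 4"
  with False have n: "real n \<ge> 5" by simp
  have "(8 * real n - 33) * 9^n \<ge> 0" using n by (intro mult_nonneg_nonneg) auto
  moreover have "real n * (480 * real n - 288) \<ge> 5 * 1" using n by (intro mult_mono) auto
  moreover have "21 * deriv_numerator_coeff n - deriv_numerator_coeff (Suc n)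
      = (8 * real n - 33) * 9^n + real n * (480 * real n - 288) + 33"
    unfolding deriv_numerator_coeff_def of_nat_Suc power_Suc by algebra
  ultimately show ?thesis by linarith
qed

text \<open>
  The coefficients of \<open>1, x\<^sup>2, x\<^sup>4, x\<^sup>6\<close> are all zero, and from \<open>x\<^sup>8\<close> on the terms alternate in
  sign, beginning with a positive one, and decrease in size. Hence the sum exceeds the sum of
  its first two terms, which is positive.
\<close>

lemma deriv_numerator_pos:
  assumes "0 < x" "x < pi/2"
  shows "deriv_numerator x > 0"
proof -
  define b where "b n = deriv_numerator_coeff (n+4) / fact (2*(n+4)) * x^(2*(n+4))" for n
  have b_pos: "b n > 0" for n
    unfolding b_def using assms deriv_numerator_coeff_pos[of "n+4"] by simp
  have x2: "x\<^sup>2 < 4"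
  proof -
    have "x < 2" using assms pi_half_less_two by linarith
    then have "x\<^sup>2 < 2\<^sup>2" using assms by (intro power_strict_mono) auto
    then show ?thesis by simp
  qed
  have b_less: "b (Suc n) < b n" for n
  proof -
    let ?m = "n + 4"
    let ?d = "(2 * real ?m + 2) * (2 * real ?m + 1)"
    have eq: "b (Suc n) = deriv_numerator_coeff (Suc ?m) * x\<^sup>2 / ?d * (x^(2*?m) / fact (2*?m))"
    proof -
      have f: "fact (2 * (Suc n + 4)) = ?d * (fact (2 * ?m) :: real)"
      proof -
        have "fact (2 * (Suc n + 4)) = (fact (Suc (Suc (2 * ?m))) :: real)" by simp
        then show ?thesis unfolding fact_Suc by (simp add: algebra_simps)
      qed
      have p: "x^(2 * (Suc n + 4)) = x\<^sup>2 * x^(2 * ?m)"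
        by (simp flip: power_add)
      show ?thesis unfolding b_def f p by simp
    qed
    have d: "?d \<ge> 10 * 9" by (intro mult_mono) auto
    have "deriv_numerator_coeff (Suc ?m) * x\<^sup>2 \<le> 21 * deriv_numerator_coeff ?m * 4"
      using deriv_numerator_coeff_growth[of ?m] deriv_numerator_coeff_pos[of ?m] x2 by (intro mult_mono) auto
    also have "\<dots> < deriv_numerator_coeff ?m * 90" using deriv_numerator_coeff_pos[of ?m] by simp
    also have "\<dots> \<le> deriv_numerator_coeff ?m * ?d" using deriv_numerator_coeff_pos[of ?m] d by (intro mult_left_mono) auto
    finally have "deriv_numerator_coeff (Suc ?m) * x\<^sup>2 / ?d < deriv_numerator_coeff ?m"
      using d by (subst pos_divide_less_eq) auto
    then have "deriv_numerator_coeff (Suc ?m) * x\<^sup>2 / ?d * (x^(2*?m) / fact (2*?m))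
        < deriv_numerator_coeff ?m * (x^(2*?m) / fact (2*?m))"
      using assms by (intro mult_strict_right_mono) auto
    then show ?thesis unfolding eq unfolding b_def by simp
  qed
  have zero: "(\<Sum>i<4. (-1)^i * (deriv_numerator_coeff i / fact (2*i) * x^(2*i))) = 0"
    by (simp add: deriv_numerator_coeff_def eval_nat_numeral)
  have "(\<lambda>n. (-1)^(n+4) * (deriv_numerator_coeff (n+4) / fact (2*(n+4)) * x^(2*(n+4)))) sums
        (deriv_numerator x - (\<Sum>i<4. (-1)^i * (deriv_numerator_coeff i / fact (2*i) * x^(2*i))))"
    using deriv_numerator_sums[of x] by (subst sums_iff_shift) simp
  then have S: "(\<lambda>n. (-1)^n * b n) sums deriv_numerator x"
    unfolding zero b_def by (simp add: power_add)
  have "(\<lambda>n. (-1)^n * b n) \<longlonglongrightarrow> 0" by (rule summable_LIMSEQ_zero[OF sums_summable[OF S]])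
  then have "(\<lambda>n. \<bar>(-1)^n * b n\<bar>) \<longlonglongrightarrow> 0" by (rule tendsto_rabs_zero)
  moreover have "\<bar>(-1)^n * b n\<bar> = b n" for n using b_pos[of n] by (simp add: abs_mult)
  ultimately have lim: "b \<longlonglongrightarrow> 0" by simp
  have "(\<Sum>i<2*1. (-1)^i * b i) \<le> (\<Sum>i. (-1)^i * b i)"
    by (rule summable_Leibniz'(2)[OF lim]) (use b_pos b_less less_imp_le in blast)+
  then have "b 0 - b 1 \<le> deriv_numerator x"
    using sums_unique[OF S] by (simp add: eval_nat_numeral)
  with b_less[of 0] show ?thesis by simp
qed

section \<open>Bounds for the ratio of tangent and argument\<close>

text \<open>
  The logarithmic form of the upper bound with exponent \<open>6/5\<close>: the right-hand side is strictly
  increasing, and near \<open>0\<close> it tends to \<open>5 ln 3\<close> because \<open>sin x - x cos x\<close> behaves like \<open>x\<^sup>3/3\<close>.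
\<close>

lemma tan_ratio_log_inequality:
  fixes x :: real
  assumes x: "0 < x" "x < pi/2"
  shows "5 * ln 3 < 9 * ln x + 6 * ln (sin x) - ln (cos x) - 5 * ln (sin x - x * cos x)"
proof -
  define F where "F t = 9 * ln t + 6 * ln (sin t) - ln (cos t) - 5 * ln (sin t - t * cos t)" for t :: real
  have der: "\<exists>y. (F has_real_derivative y) (at t) \<and> y > 0" if t: "0 < t" "t < pi/2" for t
  proof -
    let ?s = "sin t" and ?c = "cos t"
    have s: "?s > 0" using t by (intro sin_gt_zero) auto
    have c: "?c > 0" using t by (intro cos_gt_zero_pi) auto
    have d: "?s - t * ?c > 0" using sin_gt_x_cos[OF t] by simp
    let ?D = "9 / t + 6 * (?c / ?s) + ?s / ?c - 5 * (t * ?s / (?s - t * ?c))"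
    have "(F has_real_derivative ?D) (at t)"
      unfolding F_def using t s c d
      by (auto intro!: derivative_eq_intros simp: field_simps)
    moreover have "?D = deriv_numerator t / (t * ?s * ?c * (?s - t * ?c))"
    proof -
      have 1: "9 * ?s * ?c + 6 * t * ?c\<^sup>2 + t * ?s\<^sup>2 = 9 * ?s * ?c + t + 5 * t * ?c\<^sup>2"
        by (simp add: sin_squared_eq algebra_simps)
      have "deriv_numerator t = (?s - t * ?c) * (9 * ?s * ?c + t + 5 * t * ?c\<^sup>2) - 5 * t\<^sup>2 * ?s\<^sup>2 * ?c"
        unfolding deriv_numerator_def using sin_cos_squared_add[of t] by algebra
      then have "deriv_numerator t = (?s - t * ?c) * (9 * ?s * ?c + 6 * t * ?c\<^sup>2 + t * ?s\<^sup>2) - 5 * t\<^sup>2 * ?s\<^sup>2 * ?c"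
        using 1 by simp
      then show ?thesis using t s c d
        by (simp add: field_simps power2_eq_square)
    qed
    moreover have "deriv_numerator t / (t * ?s * ?c * (?s - t * ?c)) > 0"
      using deriv_numerator_pos[OF t] t s c d by simp
    ultimately show ?thesis by auto
  qed
  have mono: "F a < F b" if "0 < a" "a < b" "b < pi/2" for a b
    by (rule DERIV_pos_imp_increasing[OF \<open>a < b\<close>]) (use der that in auto)
  have lim: "(F \<longlongrightarrow> 5 * ln 3) (at_right 0)"
    unfolding F_def by (real_asymp simp: ln_div)
  \<comment> \<open>Passing to the limit loses strictness; the detour over \<open>x/2\<close> restores it.\<close>
  have "5 * ln 3 \<le> F (x/2)"
  proof (rule tendsto_upperbound[OF lim])
    have "eventually (\<lambda>t. t \<in> {0<..<x/2}) (at_right 0)"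
      using x by (intro eventually_at_right_real) auto
    then show "\<forall>\<^sub>F t in at_right 0. F t \<le> F (x/2)"
      by eventually_elim (use mono x in \<open>auto intro!: less_imp_le\<close>)
  qed simp
  also have "\<dots> < F x" using mono x by simp
  finally show ?thesis by (simp add: F_def)
qed

lemma tan_ratio_gt_one:
  fixes x :: real
  assumes "0 < x" "x < pi/2"
  shows "tan x / x > 1"
proof -
  have "cos x > 0" using assms by (intro cos_gt_zero_pi) auto
  then show ?thesis using assms sin_gt_x_cos[OF assms] by (simp add: tan_def field_simps)
qed

lemma tan_ratio_lower_bound:
  fixes x :: real
  assumes x: "0 < x" "x < pi/2"
  shows "1 + x\<^sup>2 / 3 * (tan x / x) < tan x / x"
proof -
  have c: "cos x > 0" using x by (intro cos_gt_zero_pi) auto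
  have "tan x / x - (1 + x\<^sup>2 / 3 * (tan x / x))
      = ((3 - x\<^sup>2) * sin x - 3 * x * cos x) / (3 * x * cos x)"
    using x c by (simp add: tan_def field_simps power2_eq_square)
  also have "\<dots> > 0" using sin_cos_cubic_lower[OF x] x c by simp
  finally show ?thesis by simp
qed

lemma tan_ratio_upper_bound:
  fixes x :: real
  assumes x: "0 < x" "x < pi/2"
  shows "tan x / x < 1 + x\<^sup>2 / 3 * (tan x / x) powr (6/5)"
proof -
  have c: "cos x > 0" using x by (intro cos_gt_zero_pi) auto
  have s: "sin x > 0" using x by (intro sin_gt_zero) auto
  have d: "sin x - x * cos x > 0" using sin_gt_x_cos[OF x] by simp
  let ?T = "tan x / x"
  have T: "?T > 1" by (rule tan_ratio_gt_one[OF x])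
  have lT: "ln ?T = ln (sin x) - ln (cos x) - ln x"
    using x c s by (simp add: tan_def ln_div ln_mult)
  have "?T - 1 = (sin x - x * cos x) / (x * cos x)"
    using x c by (simp add: tan_def field_simps)
  then have lT1: "ln (?T - 1) = ln (sin x - x * cos x) - ln x - ln (cos x)"
    using x c d by (simp add: ln_div ln_mult)
  have "ln (x\<^sup>2 / 3 * ?T powr (6/5)) = 2 * ln x - ln 3 + 6/5 * ln ?T"
    using x T by (subst ln_mult) (auto simp: ln_div ln_realpow ln_powr)
  moreover have "ln (?T - 1) < 2 * ln x - ln 3 + 6/5 * ln ?T"
    unfolding lT lT1 using tan_ratio_log_inequality[OF x] by argo
  ultimately have "ln (?T - 1) < ln (x\<^sup>2 / 3 * ?T powr (6/5))" by simp
  moreover have "x\<^sup>2 / 3 * ?T powr (6/5) > 0" using x T by simp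
  ultimately have "?T - 1 < x\<^sup>2 / 3 * ?T powr (6/5)"
    using T by (subst (asm) ln_less_cancel_iff) simp_all
  then show ?thesis by (simp only: diff_less_eq add.commute)
qed

section \<open>Optimality of the exponents\<close>

text \<open>
  If \<open>a > 1\<close>, then near \<open>\<pi>/2\<close> the factor \<open>x\<^sup>2/3 T powr (a - 1)\<close> exceeds \<open>1\<close>, which contradicts the
  assumed inequality.
\<close>

lemma lower_exponent_le_one:
  fixes a :: real
  assumes ineq: "\<And>x. 0 < x \<Longrightarrow> x < pi/2 \<Longrightarrow> 1 + x\<^sup>2 / 3 * (tan x / x) powr a < tan x / x"
  shows "a \<le> 1"
proof (rule ccontr)
  assume "\<not> a \<le> 1"
  then have a: "a - 1 > 0" by simp
  \<comment> \<open>Below, \<open>1/2 < x < 2\<close>: the bound \<open>x < 2\<close> turns this into \<open>T powr (a - 1) > 12\<close>, and \<open>x > 1/2\<close>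
    gives \<open>x\<^sup>2 / 3 > 1 / 12\<close>.\<close>
  have "\<forall>\<^sub>F x in at_left (pi/2). tan x > 2 * 12 powr (1 / (a - 1))"
    using filterlim_tan_at_left by (auto simp: filterlim_at_top_dense)
  moreover have "\<forall>\<^sub>F x in at_left (pi/2). x \<in> {pi/4<..<pi/2}"
    by (intro eventually_at_left_real) auto
  ultimately have "\<forall>\<^sub>F x in at_left (pi/2). False"
  proof eventually_elim
    case (elim x)
    let ?T = "tan x / x"
    have x: "1/2 < x" "x < 2" "0 < x" "x < pi/2"
      using elim pi_ge_two pi_half_less_two by auto
    have "12 powr (1 / (a - 1)) * x < tan x"
    proof -
      have "12 powr (1 / (a - 1)) * x < 12 powr (1 / (a - 1)) * 2"
        using x by (intro mult_strict_left_mono) auto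
      then show ?thesis using elim by linarith
    qed
    then have T: "12 powr (1 / (a - 1)) < ?T" using x by (simp add: field_simps)
    have "12 = (12 powr (1 / (a - 1))) powr (a - 1)" using a by (simp add: powr_powr)
    also have "\<dots> < ?T powr (a - 1)" using T a by (intro powr_less_mono2) auto
    finally have large: "12 < ?T powr (a - 1)" .
    have T1: "?T > 1" by (rule tan_ratio_gt_one) (use x in auto)
    have "?T = (1/2)\<^sup>2 / 3 * 12 * ?T" by (simp add: power2_eq_square)
    also have "\<dots> < x\<^sup>2 / 3 * ?T powr (a - 1) * ?T"
      using x T1 large by (intro mult_strict_right_mono mult_strict_mono divide_strict_right_mono power_strict_mono) auto
    also have "\<dots> = x\<^sup>2 / 3 * ?T powr a"
    proof -
      have "?T powr a = ?T * ?T powr (a - 1)"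
        using T1 powr_mult_base[of ?T "a - 1"] by simp
      then show ?thesis by (simp only: mult.assoc mult.commute mult.left_commute)
    qed
    also have "\<dots> < 1 + x\<^sup>2 / 3 * ?T powr a" by simp
    finally show False using ineq[OF x(3,4)] by (rule less_asym)
  qed
  then show False by (simp add: trivial_limit_at_left_real)
qed

text \<open>
  The inequality says that \<open>b\<close> exceeds \<open>ln (3 (T - 1) / x\<^sup>2) / ln T\<close> everywhere, hence is at least
  the limit of this quotient at \<open>0\<close>.
\<close>

lemma upper_exponent_ge:
  fixes b :: real
  assumes ineq: "\<And>x. 0 < x \<Longrightarrow> x < pi/2 \<Longrightarrow> tan x / x < 1 + x\<^sup>2 / 3 * (tan x / x) powr b"
  shows "b \<ge> 6/5"
proof -
  have lim: "((\<lambda>x::real. ln (3 * (tan x / x - 1) / x\<^sup>2) / ln (tan x / x)) \<longlongrightarrow> 6/5) (at_right 0)"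
    by real_asymp
  show ?thesis
  proof (rule tendsto_upperbound[OF lim])
    have "\<forall>\<^sub>F x in at_right 0. x \<in> {0<..<pi/2}"
      by (intro eventually_at_right_real) auto
    then show "\<forall>\<^sub>F x in at_right 0. ln (3 * (tan x / x - 1) / x\<^sup>2) / ln (tan x / x) \<le> b"
    proof eventually_elim
      case (elim x)
      then have x: "0 < x" "x < pi/2" by auto
      have T: "tan x / x > 1" by (rule tan_ratio_gt_one[OF x])
      have "3 * (tan x / x - 1) < 3 * (x\<^sup>2 / 3 * (tan x / x) powr b)"
        using ineq[OF x] by (simp only: mult_less_cancel_left_pos zero_less_numeral diff_less_eq add.commute)
      also have "\<dots> = (tan x / x) powr b * x\<^sup>2" by simp
      finally have "3 * (tan x / x - 1) / x\<^sup>2 < (tan x / x) powr b"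
        using x(1) by (subst pos_divide_less_eq) simp_all
      then have "ln (3 * (tan x / x - 1) / x\<^sup>2) < ln ((tan x / x) powr b)"
      proof (subst ln_less_cancel_iff)
        show "0 < 3 * (tan x / x - 1) / x\<^sup>2"
          using T x(1) by (intro divide_pos_pos mult_pos_pos) (simp_all only: diff_gt_0_iff_gt zero_less_numeral zero_less_power)
      qed (use x T in auto)
      also have "\<dots> = b * ln (tan x / x)" using T by (simp add: ln_powr)
      finally show ?case using T by (subst pos_divide_le_eq) auto
    qed
  qed simp
qed

section \<open>The sharp exponents\<close>

theorem corollary5:
  fixes \<alpha> \<beta> :: real
  shows "(\<forall>x::real. - pi / 2 < x \<and> x < pi / 2 \<and> x \<noteq> 0 \<longrightarrow>
            1 + x\<^sup>2 / 3 * (tan x / x) powr \<alpha> < tan x / x \<and>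
            tan x / x < 1 + x\<^sup>2 / 3 * (tan x / x) powr \<beta>)
         \<longleftrightarrow> \<alpha> \<le> 1 \<and> \<beta> \<ge> 6 / 5"
proof
  assume "\<forall>x::real. - pi / 2 < x \<and> x < pi / 2 \<and> x \<noteq> 0 \<longrightarrow>
            1 + x\<^sup>2 / 3 * (tan x / x) powr \<alpha> < tan x / x \<and>
            tan x / x < 1 + x\<^sup>2 / 3 * (tan x / x) powr \<beta>"
  then show "\<alpha> \<le> 1 \<and> \<beta> \<ge> 6 / 5"
    by (intro conjI lower_exponent_le_one upper_exponent_ge) auto
next
  assume ab: "\<alpha> \<le> 1 \<and> \<beta> \<ge> 6 / 5"
  have pos: "1 + x\<^sup>2 / 3 * (tan x / x) powr \<alpha> < tan x / x \<and>
            tan x / x < 1 + x\<^sup>2 / 3 * (tan x / x) powr \<beta>" if x: "0 < x" "x < pi/2" for x :: real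
  proof -
    let ?T = "tan x / x"
    have T: "?T > 1" by (rule tan_ratio_gt_one[OF x])
    have "?T powr \<alpha> \<le> ?T powr 1" using ab T by (intro powr_mono) auto
    then have "x\<^sup>2 / 3 * ?T powr \<alpha> \<le> x\<^sup>2 / 3 * ?T" 
      using T by (intro mult_left_mono) auto
    moreover have "?T powr (6/5) \<le> ?T powr \<beta>" using ab T by (intro powr_mono) auto
    then have "x\<^sup>2 / 3 * ?T powr (6/5) \<le> x\<^sup>2 / 3 * ?T powr \<beta>" 
      by (intro mult_left_mono) auto
    ultimately show ?thesis using tan_ratio_lower_bound[OF x] tan_ratio_upper_bound[OF x] by linarith
  qed
  show "\<forall>x::real. - pi / 2 < x \<and> x < pi / 2 \<and> x \<noteq> 0 \<longrightarrow>
            1 + x\<^sup>2 / 3 * (tan x / x) powr \<alpha> < tan x / x \<and>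
            tan x / x < 1 + x\<^sup>2 / 3 * (tan x / x) powr \<beta>"
  proof (intro allI impI)
    fix x :: real
    assume x: "- pi / 2 < x \<and> x < pi / 2 \<and> x \<noteq> 0"
    show "1 + x\<^sup>2 / 3 * (tan x / x) powr \<alpha> < tan x / x \<and>
            tan x / x < 1 + x\<^sup>2 / 3 * (tan x / x) powr \<beta>"
    proof (cases "x > 0")
      case True
      then show ?thesis using pos x by auto
    next
      case False
      then show ?thesis using pos[of "-x"] x by auto
    qed
  qed
qed

end
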